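(* For every $\tau \in (0,1)$, there is a polynomial time $\left(\frac{\tau}{4}, \frac{\tau^2}{32}\right)$-approximation algorithm for the $\tau$-TC problem. That is, there is a polynomial time algorithm that, given any $v_1,\dots,v_n\in\mathbb{R}^d$ with $\|v_i\|\le 1$ and weights $w_1,\dots,w_n\ge 0$, returns a unit vector $x\in\mathbb{R}^d$ such that $$\sum_{i\in[n]} \mathbf{1}\!\left[\langle x,v_i\rangle^2\ge\tfrac{\tau}{4}\cdot\tau\right] w_i\langle x,v_i\rangle^2\ \ge\ \frac{\tau^2}{32}\cdot\mathrm{Opt},$$ where $\mathrm{Opt}$ is the optimum value of the $\tau$-TC instance.
   Context: The $\tau$-TC (threshold correlation) problem: given vectors $v_1,\dots,v_n$ in the closed Euclidean unit ball of $\mathbb{R}^d$, non-negative weights $w_1,\dots,w_n$, and a threshold $\tau\in[0,1]$, find a unit vector $x\in\mathbb{R}^d$ maximizing $\sum_{i\in[n]} \mathbf{1}[\langle x,v_i\rangle^2\ge\tau]\, w_i\langle x,v_i\rangle^2$. $\mathrm{Opt}$ denotes the maximum value. For $0\le\alpha,\beta\le1$, an $(\alpha,\beta)$-approximation algorithm is one that returns a unit vector $x\in\mathbb{R}^d$ with $\sum_{i\in[n]} \mathbf{1}[\langle x,v_i\rangle^2\ge\alpha\tau]\, w_i\langle x,v_i\rangle^2\ge\beta\cdot\mathrm{Opt}$. *)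

theory Defs
  imports
    "Jordan_Normal_Form.Matrix"
    "HOL-Computational_Algebra.Polynomial"
begin

section \<open>The threshold correlation problem\<close>

definition vec_norm :: "real vec \<Rightarrow> real" where
  "vec_norm x = sqrt (x \<bullet> x)"

definition unit_vecs :: "nat \<Rightarrow> real vec set" where
  "unit_vecs d = {x \<in> carrier_vec d. vec_norm x = 1}"

text \<open>The indices \<open>1, \<dots>, n\<close> are shifted to \<open>0, \<dots>, n - 1\<close>. The case \<open>d = 0\<close> is excluded because
  there is no unit vector in dimension \<open>0\<close>.\<close>

definition tc_instance :: "nat \<Rightarrow> nat \<Rightarrow> (nat \<Rightarrow> real vec) \<Rightarrow> (nat \<Rightarrow> real) \<Rightarrow> bool" where
  "tc_instance n d v w \<longleftrightarrow>
     d \<ge> 1 \<and> (\<forall>i<n. v i \<in> carrier_vec d \<and> vec_norm (v i) \<le> 1 \<and> w i \<ge> 0)"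

definition tc_value :: "real \<Rightarrow> nat \<Rightarrow> (nat \<Rightarrow> real vec) \<Rightarrow> (nat \<Rightarrow> real) \<Rightarrow> real vec \<Rightarrow> real" where
  "tc_value \<theta> n v w x = (\<Sum>i<n. of_bool ((x \<bullet> v i)\<^sup>2 \<ge> \<theta>) * (w i * (x \<bullet> v i)\<^sup>2))"

text \<open>On an instance the set below is nonempty and bounded, and its supremum is a maximum:
  the objective is upper semicontinuous on the compact unit sphere.\<close>

definition tc_opt :: "real \<Rightarrow> nat \<Rightarrow> nat \<Rightarrow> (nat \<Rightarrow> real vec) \<Rightarrow> (nat \<Rightarrow> real) \<Rightarrow> real" where
  "tc_opt \<tau> n d v w = (SUP x\<in>unit_vecs d. tc_value \<tau> n v w x)"


section \<open>A model of computation over the reals\<close>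

text \<open>
  Inputs and outputs are real vectors, so algorithms are programs for a unit-cost real random
  access machine. The machine has index registers holding natural numbers and arrays of real
  cells. On reals it has field arithmetic and comparison only: there are no roots, no rounding
  and no conversion from reals to indices, and program constants are rational. On indices
  there is addition and truncated subtraction but no multiplication, so that after \<open>t\<close> steps
  of a fixed program the indices have only \<open>O(t + log N)\<close> bits, where \<open>N\<close> bounds the initial
  ones. A program is a single finite object, used for all values of \<open>n\<close> and \<open>d\<close>.
\<close>

datatype iexp =
    IConst nat
  | IReg string
  | IAdd iexp iexp
  | ISub iexp iexp

datatype rexp =
    RConst rat
  | RCell string iexp
  | RAdd rexp rexp
  | RSub rexp rexp
  | RMul rexp rexp
  | RDiv rexp rexp

datatype test =
    ILess iexp iexp
  | RLess rexp rexp

datatype com =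
    Skip
  | ISet string iexp
  | RSet string iexp rexp
  | Seq com com
  | If test com com
  | While test com

type_synonym state = "(string \<Rightarrow> nat) \<times> (string \<Rightarrow> nat \<Rightarrow> real)"

fun ival :: "iexp \<Rightarrow> state \<Rightarrow> nat" where
  "ival (IConst c) s = c"
| "ival (IReg r) s = fst s r"
| "ival (IAdd a b) s = ival a s + ival b s"
| "ival (ISub a b) s = ival a s - ival b s"

fun rval :: "rexp \<Rightarrow> state \<Rightarrow> real" where
  "rval (RConst c) s = of_rat c"
| "rval (RCell a e) s = snd s a (ival e s)"
| "rval (RAdd e f) s = rval e s + rval f s"
| "rval (RSub e f) s = rval e s - rval f s"
| "rval (RMul e f) s = rval e s * rval f s"
| "rval (RDiv e f) s = rval e s / rval f s"

fun tval :: "test \<Rightarrow> state \<Rightarrow> bool" where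
  "tval (ILess a b) s \<longleftrightarrow> ival a s < ival b s"
| "tval (RLess e f) s \<longleftrightarrow> rval e s < rval f s"

fun set_reg :: "string \<Rightarrow> nat \<Rightarrow> state \<Rightarrow> state" where
  "set_reg r k (R, A) = (R(r := k), A)"

fun set_cell :: "string \<Rightarrow> nat \<Rightarrow> real \<Rightarrow> state \<Rightarrow> state" where
  "set_cell a i y (R, A) = (R, A(a := (A a)(i := y)))"

text \<open>\<open>exec c s t s'\<close>: started in \<open>s\<close>, the program \<open>c\<close> halts in \<open>s'\<close> after \<open>t\<close> steps. One
  step is one assignment or one test (or \<open>Skip\<close>). The expressions occurring in it are part of
  the fixed program, so counting single arithmetic operations instead changes the running time
  by a constant factor only.\<close>

inductive exec :: "com \<Rightarrow> state \<Rightarrow> nat \<Rightarrow> state \<Rightarrow> bool" where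
  Skip: "exec Skip s 1 s"
| ISet: "exec (ISet r e) s 1 (set_reg r (ival e s) s)"
| RSet: "exec (RSet a i e) s 1 (set_cell a (ival i s) (rval e s) s)"
| Seq: "exec c s t s' \<Longrightarrow> exec c' s' t' s'' \<Longrightarrow> exec (Seq c c') s (t + t') s''"
| IfTrue: "tval b s \<Longrightarrow> exec c s t s' \<Longrightarrow> exec (If b c c') s (Suc t) s'"
| IfFalse: "\<not> tval b s \<Longrightarrow> exec c' s t s' \<Longrightarrow> exec (If b c c') s (Suc t) s'"
| WhileFalse: "\<not> tval b s \<Longrightarrow> exec (While b c) s 1 s"
| WhileTrue: "tval b s \<Longrightarrow> exec c s t s' \<Longrightarrow> exec (While b c) s' t' s'' \<Longrightarrow>
    exec (While b c) s (Suc (t + t')) s''"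

inductive_cases exec_SkipE: "exec Skip s t s'"
inductive_cases exec_ISetE: "exec (ISet r e) s t s'"
inductive_cases exec_RSetE: "exec (RSet a i e) s t s'"
inductive_cases exec_SeqE: "exec (Seq c c') s t s'"
inductive_cases exec_IfE: "exec (If b c c') s t s'"
inductive_cases exec_WhileE: "exec (While b c) s t s'"

lemma exec_deterministic:
  "exec c s t s' \<Longrightarrow> exec c s u s'' \<Longrightarrow> t = u \<and> s' = s''"
proof (induction arbitrary: u s'' rule: exec.induct)
  case (Skip s)
  then show ?case by (auto elim: exec_SkipE)
next
  case (ISet r e s)
  then show ?case by (auto elim: exec_ISetE)
next
  case (RSet a i e s)
  then show ?case by (auto elim: exec_RSetE)
next
  case (Seq c s t s' c' t' s2)
  from Seq.prems show ?case
    by (rule exec_SeqE) (use Seq.IH in blast)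
next
  case (IfTrue b s c t s' c')
  from IfTrue.prems show ?case
    by (rule exec_IfE) (use IfTrue.IH IfTrue.hyps in blast)+
next
  case (IfFalse b s c' t s' c)
  from IfFalse.prems show ?case
    by (rule exec_IfE) (use IfFalse.IH IfFalse.hyps in blast)+
next
  case (WhileFalse b s c)
  from WhileFalse.prems show ?case
    by (rule exec_WhileE) (use WhileFalse.hyps in simp_all)
next
  case (WhileTrue b s c t s' t' s2)
  from WhileTrue.prems show ?case
    by (rule exec_WhileE) (use WhileTrue.IH WhileTrue.hyps in blast)+
qed


section \<open>Approximation algorithms for threshold correlation\<close>

text \<open>The vectors are stored row by row: coordinate \<open>k\<close> of \<open>v i\<close> is in cell \<open>i * d + k\<close> of the
  array \<open>v\<close>. Everything that is not part of the input is initially \<open>0\<close>.\<close>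

definition tc_input ::
  "real \<Rightarrow> nat \<Rightarrow> nat \<Rightarrow> (nat \<Rightarrow> real vec) \<Rightarrow> (nat \<Rightarrow> real) \<Rightarrow> state" where
  "tc_input \<tau> n d v w =
     ((\<lambda>r. if r = ''n'' then n else if r = ''d'' then d else 0),
      (\<lambda>a j. if a = ''v'' \<and> j < n * d then v (j div d) $ (j mod d)
             else if a = ''w'' \<and> j < n then w j
             else if a = ''tau'' \<and> j = 0 then \<tau>
             else 0))"

definition tc_output :: "nat \<Rightarrow> state \<Rightarrow> real vec" where
  "tc_output d s = vec d (snd s ''x'')"

definition tc_polynomial_time :: "real \<Rightarrow> com \<Rightarrow> bool" where
  "tc_polynomial_time \<tau> P \<longleftrightarrow>
     (\<exists>p :: nat poly. \<forall>n d v w. tc_instance n d v w \<longrightarrow>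
        (\<exists>t s. exec P (tc_input \<tau> n d v w) t s \<and> t \<le> poly p (n + d)))"

definition tc_approximation_algorithm :: "real \<Rightarrow> real \<Rightarrow> real \<Rightarrow> com \<Rightarrow> bool" where
  "tc_approximation_algorithm \<alpha> \<beta> \<tau> P \<longleftrightarrow>
     (\<forall>n d v w. tc_instance n d v w \<longrightarrow>
        (\<exists>t s. exec P (tc_input \<tau> n d v w) t s \<and>
               tc_output d s \<in> unit_vecs d \<and>
               tc_value (\<alpha> * \<tau>) n v w (tc_output d s) \<ge> \<beta> * tc_opt \<tau> n d v w))"

end

theory Submission
  imports Defs "HOL-Analysis.Convex"
begin

text \<open>Some input vector, normalised, is already a good solution. Let \<open>x\<close> be a unit vector, \<open>S\<close> the set
  of indices it satisfies and \<open>W\<close> the total weight of \<open>S\<close>. Then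
  \<open>(\<Sum>i,j\<in>S. w i * w j * (v i \<bullet> v j)\<^sup>2) \<ge> (\<Sum>i\<in>S. w i * (x \<bullet> v i)\<^sup>2)\<^sup>2 \<ge> \<tau>\<^sup>2 * W\<^sup>2\<close>, so some \<open>i \<in> S\<close> has
  \<open>(\<Sum>j\<in>S. w j * (v i \<bullet> v j)\<^sup>2) \<ge> \<tau>\<^sup>2 * W\<close>, of which terms below the threshold \<open>\<tau>\<^sup>2 / 4\<close> account for at
  most a quarter. Hence it suffices to try all \<open>v i\<close>. The machine cannot take the square root needed
  to normalise \<open>v i\<close>, so a constant number \<open>m\<close> of Newton steps, depending on \<open>\<tau>\<close> only, approximates
  the norm, and a rational reflection turns this into a vector of norm exactly \<open>1\<close> near the
  direction of \<open>v i\<close>. The constants leave room for the error.\<close>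

section \<open>Timed weakest preconditions\<close>

text \<open>An upper bound \<open>T\<close> instead of an exact step count lets branches of
  different length share one estimate. With a predicate on states as postcondition, sequencing
  becomes nesting of \<open>runs\<close>.\<close>

definition runs :: "com \<Rightarrow> state \<Rightarrow> nat \<Rightarrow> (state \<Rightarrow> bool) \<Rightarrow> bool" where
  "runs c s T Q \<longleftrightarrow> (\<exists>t s'. exec c s t s' \<and> t \<le> T \<and> Q s')"

lemma runs_mono:
  "runs c s T Q \<Longrightarrow> T \<le> T' \<Longrightarrow> (\<And>s'. Q s' \<Longrightarrow> Q' s') \<Longrightarrow> runs c s T' Q'"
  unfolding runs_def by (meson order_trans)

lemma runs_Skip: "Q s \<Longrightarrow> 1 \<le> T \<Longrightarrow> runs Skip s T Q"
  unfolding runs_def using exec.Skip by blast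

lemma runs_ISet: "Q (set_reg r (ival e s) s) \<Longrightarrow> 1 \<le> T \<Longrightarrow> runs (ISet r e) s T Q"
  unfolding runs_def using exec.ISet by blast

lemma runs_RSet: "Q (set_cell a (ival i s) (rval e s) s) \<Longrightarrow> 1 \<le> T \<Longrightarrow> runs (RSet a i e) s T Q"
  unfolding runs_def using exec.RSet by blast

lemma runs_Seq:
  assumes "runs c s T (\<lambda>s'. runs c' s' T' Q)" "T + T' \<le> T''"
  shows "runs (Seq c c') s T'' Q"
proof -
  from assms(1) obtain t s' where 1: "exec c s t s'" "t \<le> T" "runs c' s' T' Q"
    unfolding runs_def by blast
  then obtain t' s'' where 2: "exec c' s' t' s''" "t' \<le> T'" "Q s''"
    unfolding runs_def by blast
  show ?thesis
    unfolding runs_def using exec.Seq[OF 1(1) 2(1)] 1(2) 2(2,3) assms(2)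
    by (intro exI[of _ "t + t'"] exI[of _ s'']) simp
qed

lemma runs_If:
  assumes "tval b s \<Longrightarrow> runs c s T Q" "\<not> tval b s \<Longrightarrow> runs c' s T Q" "Suc T \<le> T'"
  shows "runs (If b c c') s T' Q"
proof (cases "tval b s")
  case True
  then obtain t s' where "exec c s t s'" "t \<le> T" "Q s'"
    using assms(1) unfolding runs_def by blast
  then show ?thesis
    unfolding runs_def using exec.IfTrue[OF True] assms(3)
    by (intro exI[of _ "Suc t"] exI[of _ s']) auto
next
  case False
  then obtain t s' where "exec c' s t s'" "t \<le> T" "Q s'"
    using assms(2) unfolding runs_def by blast
  then show ?thesis
    unfolding runs_def using exec.IfFalse[OF False] assms(3)
    by (intro exI[of _ "Suc t"] exI[of _ s']) auto
qed

section \<open>Counting loops and their running time\<close>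

definition for_loop :: "string \<Rightarrow> string \<Rightarrow> com \<Rightarrow> com" where
  "for_loop k n c = Seq (ISet k (IConst 0))
     (While (ILess (IReg k) (IReg n)) (Seq c (ISet k (IAdd (IReg k) (IConst 1)))))"

text \<open>The invariant speaks of states whose counter is already set, so callers never treat the
  increment separately. Each round costs the body, a test and an increment; the extra 2 pays for the
  initial assignment and the failing last test.\<close>

lemma runs_for_loop:
  assumes init: "I 0 (set_reg k 0 s)"
    and regs: "\<And>i s. I i s \<Longrightarrow> fst s k = i \<and> fst s n = N"
    and body: "\<And>i s. i < N \<Longrightarrow> I i s \<Longrightarrow>
      runs c s T (\<lambda>s'. fst s' k = i \<and> I (Suc i) (set_reg k (Suc i) s'))"
    and post: "\<And>s'. I N s' \<Longrightarrow> Q s'"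
    and time: "2 + N * (T + 2) \<le> T'"
  shows "runs (for_loop k n c) s T' Q"
proof -
  let ?W = "While (ILess (IReg k) (IReg n)) (Seq c (ISet k (IAdd (IReg k) (IConst 1))))"
  \<comment> \<open>Induction on the number \<open>m\<close> of rounds still to come, with the
    counter value left free.\<close>
  have W: "runs ?W s (1 + m * (T + 2)) (I N)" if "I i s" "i + m = N" for i m s
    using that
  proof (induction m arbitrary: i s)
    case 0
    have "exec ?W s 1 s" using regs[OF 0(1)] 0(2) by (intro exec.WhileFalse) simp
    then show ?case unfolding runs_def using 0 by (intro exI[of _ 1] exI[of _ s]) auto
  next
    case (Suc m)
    obtain t s' where 1: "exec c s t s'" "t \<le> T" "fst s' k = i" "I (Suc i) (set_reg k (Suc i) s')"
      using body[of i s] Suc.prems unfolding runs_def by auto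
    obtain u s'' where 2: "exec ?W (set_reg k (Suc i) s') u s''" "u \<le> 1 + m * (T + 2)" "I N s''"
      using Suc.IH[OF 1(4)] Suc.prems unfolding runs_def by auto
    have "exec (ISet k (IAdd (IReg k) (IConst 1))) s' 1 (set_reg k (Suc i) s')"
      using exec.ISet[of k "IAdd (IReg k) (IConst 1)" s'] 1(3) by simp
    then have "exec ?W s (Suc ((t + 1) + u)) s''"
      using regs[OF Suc.prems(1)] Suc.prems(2)
      by (intro exec.WhileTrue[OF _ exec.Seq[OF 1(1)] 2(1)]) auto
    then show ?case
      unfolding runs_def using 1(2) 2(2,3) by (intro exI[of _ "Suc (t + 1 + u)"] exI[of _ s'']) auto
  qed
  have "runs ?W (set_reg k 0 s) (1 + N * (T + 2)) Q"
    using runs_mono[OF W[OF init, of N] order_refl post] by simp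
  then show ?thesis
    unfolding for_loop_def using time
    by (intro runs_Seq[of _ _ 1 _ "1 + N * (T + 2)"] runs_ISet) simp_all
qed

definition sum_loop :: "string \<Rightarrow> rexp \<Rightarrow> com" where
  "sum_loop a e = Seq (RSet a (IConst 0) (RConst 0))
     (for_loop ''k'' ''d'' (RSet a (IConst 0) (RAdd (RCell a (IConst 0)) e)))"

text \<open>Quantifying over \<open>z\<close> requires the summand to have the same value whatever
  partial sum the accumulator holds.\<close>

lemma runs_sum_loop:
  assumes "R ''d'' = d"
    and e: "\<And>k z. k < d \<Longrightarrow> rval e (R(''k'' := k), A(a := (A a)(0 := z))) = f k"
    and Q: "Q (R(''k'' := d), A(a := (A a)(0 := \<Sum>k<d. f k)))"
    and T: "3 + d * 3 \<le> T"
  shows "runs (sum_loop a e) (R, A) T Q"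
  unfolding sum_loop_def
  apply (rule runs_Seq[where T = 1 and T' = "2 + d * 3"])
   apply (rule runs_RSet)
    apply (rule runs_for_loop[where N = d and T = 1 and
        I = "\<lambda>i s. s = (R(''k'' := i), A(a := (A a)(0 := \<Sum>k<i. f k)))"])
  using assms by (auto intro!: runs_RSet)

definition fill_loop :: "string \<Rightarrow> rexp \<Rightarrow> com" where
  "fill_loop a e = for_loop ''k'' ''d'' (RSet a (IReg ''k'') e)"

lemma runs_fill_loop:
  assumes "R ''d'' = d"
    and e: "\<And>k z. k < d \<Longrightarrow> rval e (R(''k'' := k), A(a := z)) = f k"
    and Q: "Q (R(''k'' := d), A(a := (\<lambda>k. if k < d then f k else A a k)))"
    and T: "2 + d * 3 \<le> T"
  shows "runs (fill_loop a e) (R, A) T Q"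
  unfolding fill_loop_def
  apply (rule runs_for_loop[where N = d and T = 1 and
        I = "\<lambda>i s. s = (R(''k'' := i), A(a := (\<lambda>k. if k < i then f k else A a k)))"])
  using assms by (auto intro!: runs_RSet ext)


section \<open>Rational unit vectors near a given direction\<close>

definition ip :: "nat \<Rightarrow> (nat \<Rightarrow> real) \<Rightarrow> (nat \<Rightarrow> real) \<Rightarrow> real" where
  "ip d f g = (\<Sum>k<d. f k * g k)"

lemma ip_cong: "(\<And>k. k < d \<Longrightarrow> f k = f' k) \<Longrightarrow> (\<And>k. k < d \<Longrightarrow> g k = g' k) \<Longrightarrow> ip d f g = ip d f' g'"
  unfolding ip_def by (auto intro: sum.cong)

lemma ip_commute: "ip d f g = ip d g f"
  unfolding ip_def by (simp add: mult.commute)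

lemma ip_Cauchy_Schwarz: "(ip d f g)\<^sup>2 \<le> ip d f f * ip d g g"
  using Cauchy_Schwarz_ineq_sum[of f g "{..<d}"] unfolding ip_def by (simp add: power2_eq_square)

lemma ip_self_nonneg: "0 \<le> ip d f f"
  unfolding ip_def by (simp add: sum_nonneg)

lemma square_le_ip_self: "k < d \<Longrightarrow> (f k)\<^sup>2 \<le> ip d f f"
  unfolding ip_def power2_eq_square by (rule member_le_sum) auto

section \<open>Square roots by Newton iteration\<close>

fun newton_sqrt :: "real \<Rightarrow> nat \<Rightarrow> real" where
  "newton_sqrt q 0 = 1"
| "newton_sqrt q (Suc m) = (newton_sqrt q m + q / newton_sqrt q m) / 2"

text \<open>All iterates stay above the root. If \<open>r\<close> is the old iterate, the new error
  of the square is \<open>(r^2 - q)^2 / (4 * r^2)\<close>, at most a quarter of the old one because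
  \<open>r^2 - q\<close> is at most \<open>r^2\<close>. This rate is uniform in \<open>q\<close> and
  is attained at \<open>q = 0\<close>.\<close>

lemma newton_sqrt:
  assumes "0 \<le> q" "q \<le> 1"
  shows "0 < newton_sqrt q m \<and> newton_sqrt q m \<le> 1 \<and> q \<le> (newton_sqrt q m)\<^sup>2 \<and>
    (newton_sqrt q m)\<^sup>2 - q \<le> (1 / 4) ^ m"
proof (induction m)
  case 0
  then show ?case using assms by simp
next
  case (Suc m)
  define r where "r = newton_sqrt q m"
  define r' where "r' = newton_sqrt q (Suc m)"
  have r: "0 < r" "r \<le> 1" "q \<le> r\<^sup>2" "r\<^sup>2 - q \<le> (1 / 4) ^ m"
    using Suc by (auto simp: r_def)
  have r': "r' = (r + q / r) / 2" by (simp add: r_def r'_def)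
  have eq: "r'\<^sup>2 - q = (r\<^sup>2 - q)\<^sup>2 / (4 * r\<^sup>2)"
    using r(1) unfolding r' by (simp add: field_simps power2_eq_square)
  have "q / r \<le> r" using r(1,3) by (simp add: field_simps power2_eq_square)
  then have "r' \<le> 1" using r(2) unfolding r' by simp
  moreover have "0 < r'" using r(1) assms unfolding r' by (simp add: add_pos_nonneg)
  moreover have "0 \<le> r'\<^sup>2 - q" unfolding eq by simp
  moreover have "(r\<^sup>2 - q)\<^sup>2 \<le> (r\<^sup>2 - q) * r\<^sup>2"
    using r(3) assms unfolding power2_eq_square[of "r\<^sup>2 - q"] by (intro mult_left_mono) auto
  then have "r'\<^sup>2 - q \<le> (r\<^sup>2 - q) / 4"
    using r(1) unfolding eq by (simp add: field_simps)
  then have "r'\<^sup>2 - q \<le> (1 / 4) ^ Suc m" using r(4) by simp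
  ultimately show ?case by (simp add: r'_def[symmetric] del: newton_sqrt.simps)
qed

section \<open>The reflected vector: its length and its correlations\<close>

definition signed_root :: "nat \<Rightarrow> nat \<Rightarrow> (nat \<Rightarrow> real) \<Rightarrow> real" where
  "signed_root m d f = (if f 0 < 0 then - newton_sqrt (ip d f f) m else newton_sqrt (ip d f f) m)"

text \<open>The squared length of the direction \<open>f + s e\<close>, where \<open>s\<close> is
  the signed root and \<open>e\<close> the first unit vector.\<close>

definition refl_den :: "nat \<Rightarrow> nat \<Rightarrow> (nat \<Rightarrow> real) \<Rightarrow> real" where
  "refl_den m d f = ip d f f + 2 * signed_root m d f * f 0 + (signed_root m d f)\<^sup>2"

text \<open>Up to sign, the image of the first unit vector \<open>e\<close> under the reflection along \<open>f + s e\<close>, where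
  \<open>s\<close> approximates the norm of \<open>f\<close> up to sign. Hence it has norm exactly \<open>1\<close>; for exact \<open>s\<close> it would be
  \<open>f / s\<close>. The sign of \<open>s\<close> keeps the denominator away from \<open>0\<close>.\<close>

definition refl_vec :: "nat \<Rightarrow> nat \<Rightarrow> (nat \<Rightarrow> real) \<Rightarrow> nat \<Rightarrow> real" where
  "refl_vec m d f k = 2 * (f 0 + signed_root m d f) / refl_den m d f * f k
     - (if k = 0 then (ip d f f - (signed_root m d f)\<^sup>2) / refl_den m d f else 0)"

lemma ip_refl_vec:
  assumes "0 < d"
  shows "ip d (refl_vec m d f) u = 2 * (f 0 + signed_root m d f) / refl_den m d f * ip d f u
     - (ip d f f - (signed_root m d f)\<^sup>2) / refl_den m d f * u 0"
proof -
  have "ip d (refl_vec m d f) u =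
      (\<Sum>k<d. 2 * (f 0 + signed_root m d f) / refl_den m d f * (f k * u k)
      - (if k = 0 then (ip d f f - (signed_root m d f)\<^sup>2) / refl_den m d f * u 0 else 0))"
    unfolding ip_def[of d "refl_vec m d f"] refl_vec_def
    by (intro sum.cong) (auto simp: algebra_simps)
  then show ?thesis
    unfolding sum_subtractf sum_distrib_left[symmetric] ip_def[of d f u] using assms by simp
qed

text \<open>With the sign of \<open>s\<close> taken from \<open>f 0\<close>, the product
  \<open>s * f 0\<close> is nonnegative, so nothing cancels and the denominator is positive even for
  \<open>f = 0\<close>. Later estimates need no case distinction on that sign.\<close>

lemma signed_root_facts:
  assumes "ip d f f \<le> 1"
  shows "(signed_root m d f)\<^sup>2 = (newton_sqrt (ip d f f) m)\<^sup>2"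
    "signed_root m d f * f 0 = newton_sqrt (ip d f f) m * \<bar>f 0\<bar>"
    "\<bar>f 0 + signed_root m d f\<bar> = \<bar>f 0\<bar> + newton_sqrt (ip d f f) m"
    "ip d f f + (newton_sqrt (ip d f f) m)\<^sup>2 \<le> refl_den m d f"
    "0 < refl_den m d f"
proof -
  let ?r = "newton_sqrt (ip d f f) m"
  have r: "0 < ?r" using newton_sqrt[OF ip_self_nonneg assms] by blast
  show 1: "(signed_root m d f)\<^sup>2 = ?r\<^sup>2" by (simp add: signed_root_def)
  show 2: "signed_root m d f * f 0 = ?r * \<bar>f 0\<bar>" by (simp add: signed_root_def)
  show "\<bar>f 0 + signed_root m d f\<bar> = \<bar>f 0\<bar> + ?r" using r by (simp add: signed_root_def)
  have "refl_den m d f = ip d f f + 2 * (?r * \<bar>f 0\<bar>) + ?r\<^sup>2"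
    unfolding refl_den_def 1 2[symmetric] by simp
  moreover have "0 \<le> ?r * \<bar>f 0\<bar>" using r by simp
  ultimately show 3: "ip d f f + ?r\<^sup>2 \<le> refl_den m d f" by simp
  have "0 < ?r\<^sup>2" using r by simp
  then show "0 < refl_den m d f" using 3 ip_self_nonneg[of d f] by linarith
qed

text \<open>Reflections preserve length, however crude the root is; after expansion this is a
  polynomial identity in \<open>q\<close>, \<open>s\<close> and \<open>a\<close>. Hence every row,
  even a zero row, yields an admissible output.\<close>

lemma refl_vec_unit:
  assumes "0 < d" "ip d f f \<le> 1"
  shows "ip d (refl_vec m d f) (refl_vec m d f) = 1"
proof -
  define s where "s = signed_root m d f"
  define q where "q = ip d f f"
  define D where "D = refl_den m d f"
  define a where "a = f 0"
  have D: "D = q + 2 * s * a + s\<^sup>2" "D \<noteq> 0"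
    using signed_root_facts(5)[OF assms(2), of m] by (auto simp: refl_den_def D_def q_def s_def a_def)
  \<comment> \<open>General in \<open>u\<close>, since it is applied both to the reflected vector
    itself and to \<open>f\<close>.\<close>
  have ip: "ip d (refl_vec m d f) u = 2 * (a + s) / D * ip d f u - (q - s\<^sup>2) / D * u 0" for u
    using ip_refl_vec[OF assms(1)] by (simp add: s_def q_def D_def a_def)
  have y0: "refl_vec m d f 0 = 2 * (a + s) / D * a - (q - s\<^sup>2) / D"
    by (simp add: refl_vec_def s_def q_def D_def a_def)
  have fy: "ip d f (refl_vec m d f) = 2 * (a + s) / D * q - (q - s\<^sup>2) / D * a"
    unfolding ip_commute[of d f "refl_vec m d f"] ip by (simp add: q_def a_def)
  have "ip d (refl_vec m d f) (refl_vec m d f)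
      = (4 * (a + s)\<^sup>2 * q - 4 * (q - s\<^sup>2) * (a + s) * a + (q - s\<^sup>2)\<^sup>2) / D\<^sup>2"
    unfolding ip[of "refl_vec m d f"] fy y0 using D(2)
    by (simp add: field_simps power2_eq_square)
  also have "4 * (a + s)\<^sup>2 * q - 4 * (q - s\<^sup>2) * (a + s) * a + (q - s\<^sup>2)\<^sup>2 = D\<^sup>2"
    unfolding D(1) by (simp add: power2_eq_square algebra_simps)
  finally show ?thesis using D(2) by simp
qed

text \<open>The reflected vector is a multiple of \<open>f\<close>, with factor at least 1 in
  absolute value, minus a multiple of \<open>e\<close>. The latter coefficient is
  \<open>(r^2 - q) / D\<close> in absolute value: the choice of \<open>m\<close> bounds the
  numerator by \<tau>^2 / 2, and the denominator is at least 2 \<tau>, so the error is at most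
  \<tau> / 4.\<close>

lemma refl_vec_correlation:
  assumes "0 < d" "ip d f f \<le> 1" "ip d u u \<le> 1" "0 < \<tau>" "\<tau> \<le> ip d f f" "(1 / 4) ^ m \<le> \<tau>\<^sup>2 / 2"
  shows "\<bar>ip d f u\<bar> - \<tau> / 4 \<le> \<bar>ip d (refl_vec m d f) u\<bar>"
proof -
  define s where "s = signed_root m d f"
  define q where "q = ip d f f"
  define D where "D = refl_den m d f"
  define r where "r = newton_sqrt q m"
  note sr = signed_root_facts[OF assms(2), of m, folded s_def q_def D_def, folded r_def]
  have r: "0 < r" "r \<le> 1" "q \<le> r\<^sup>2" "r\<^sup>2 - q \<le> \<tau>\<^sup>2 / 2"
    using newton_sqrt[OF ip_self_nonneg assms(2), of m] assms(6) by (auto simp: r_def q_def)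
  have "(u 0)\<^sup>2 \<le> 1" using square_le_ip_self[of 0 d u] assms(1,3) by simp
  then have u0: "\<bar>u 0\<bar> \<le> 1" by (simp add: abs_square_le_1)
  have "(f 0)\<^sup>2 \<le> 1" using square_le_ip_self[of 0 d f] assms(1,2) by simp
  have Deq: "D = q + 2 * (r * \<bar>f 0\<bar>) + r\<^sup>2"
    using sr(1,2) by (simp add: D_def refl_den_def q_def s_def)
  \<comment> \<open>The factor of \<open>f\<close> is at least 1 in absolute value because
    \<open>q \<le> r^2 \<le> r \<le> 1\<close> bounds \<open>D\<close> by twice the sum of
    \<open>r\<close> and the absolute value of \<open>f 0\<close>.\<close>
  have "r * \<bar>f 0\<bar> \<le> \<bar>f 0\<bar>" "r\<^sup>2 \<le> r"
    using r(1,2) by (auto simp: power2_eq_square intro: mult_left_le_one_le)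
  then have "D \<le> 2 * \<bar>f 0 + s\<bar>" unfolding Deq sr(3) using r(3) by argo
  then have "D \<le> \<bar>2 * (f 0 + s)\<bar>" by (simp only: abs_mult abs_numeral)
  then have B: "1 \<le> \<bar>2 * (f 0 + s) / D\<bar>" using sr(5) by simp
  have "2 * \<tau> \<le> D" using sr(4) r(3) assms(5) by (simp add: q_def)
  have "\<bar>(q - s\<^sup>2) / D\<bar> = (r\<^sup>2 - q) / D" using sr(1,5) r(3) by simp
  also have "\<dots> \<le> (\<tau>\<^sup>2 / 2) / (2 * \<tau>)"
    using \<open>2 * \<tau> \<le> D\<close> r(3,4) assms(4) by (intro frac_le) auto
  also have "\<dots> = \<tau> / 4" using assms(4) by (simp add: power2_eq_square)
  finally have "\<bar>(q - s\<^sup>2) / D\<bar> * \<bar>u 0\<bar> \<le> \<tau> / 4 * 1"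
    using u0 assms(4) by (intro mult_mono) auto
  moreover have "1 * \<bar>ip d f u\<bar> \<le> \<bar>2 * (f 0 + s) / D\<bar> * \<bar>ip d f u\<bar>"
    using B by (intro mult_right_mono) auto
  moreover have "ip d (refl_vec m d f) u = 2 * (f 0 + s) / D * ip d f u - (q - s\<^sup>2) / D * u 0"
    using ip_refl_vec[OF assms(1)] by (simp add: s_def q_def D_def)
  ultimately show ?thesis unfolding abs_mult[symmetric] by argo
qed


section \<open>The approximation guarantee\<close>

text \<open>The objective on coordinate functions, the form in which the arrays of the machine hold
  vectors.\<close>

definition threshold_value ::
  "real \<Rightarrow> nat \<Rightarrow> nat \<Rightarrow> (nat \<Rightarrow> nat \<Rightarrow> real) \<Rightarrow> (nat \<Rightarrow> real) \<Rightarrow> (nat \<Rightarrow> real) \<Rightarrow> real" where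
  "threshold_value \<theta> n d V w y = (\<Sum>j<n. of_bool (\<theta> \<le> (ip d y (V j))\<^sup>2) * (w j * (ip d y (V j))\<^sup>2))"

text \<open>With \<open>M = (\<Sum>i\<in>S. w i * V i * (V i)\<^sup>T)\<close>, this says that the squared Frobenius norm of \<open>M\<close> is at
  least the square of its quadratic form at a unit vector.\<close>

lemma gram_squares_ge:
  assumes "finite S" "ip d x x = 1"
  shows "(\<Sum>i\<in>S. w i * (ip d x (V i))\<^sup>2)\<^sup>2 \<le> (\<Sum>i\<in>S. \<Sum>j\<in>S. w i * w j * (ip d (V i) (V j))\<^sup>2)"
proof -
  \<comment> \<open>\<open>M\<close> and \<open>X\<close> are matrices read as vectors indexed by
    pairs. \<open>X\<close> is the rank-one matrix of \<open>x\<close>, of Frobenius norm 1, and its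
    inner product with \<open>M\<close> is the quadratic form at \<open>x\<close>; Cauchy-Schwarz
    for the two is the claim.\<close>
  define M where "M = (\<lambda>(k, l). \<Sum>i\<in>S. w i * V i k * V i l)"
  define X where "X = (\<lambda>(k, l). x k * x l)"
  let ?K = "{..<d} \<times> {..<d}"
  have ip2: "ip d f g * ip d f' g' = (\<Sum>(k, l)\<in>?K. f k * g k * (f' l * g' l))" for f g f' g'
    unfolding ip_def sum_product sum.cartesian_product by simp
  have 1: "(\<Sum>p\<in>?K. M p * X p) = (\<Sum>i\<in>S. w i * (ip d x (V i))\<^sup>2)"
    unfolding power2_eq_square ip2 sum_distrib_left
    by (subst sum.swap) (auto simp: M_def X_def sum_distrib_left sum_distrib_right mult_ac intro!: sum.cong)
  have 2: "(\<Sum>p\<in>?K. (X p)\<^sup>2) = 1"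
  proof -
    have "(\<Sum>p\<in>?K. (X p)\<^sup>2) = ip d x x * ip d x x"
      unfolding ip2 by (auto simp: X_def power2_eq_square mult_ac intro!: sum.cong)
    then show ?thesis using assms(2) by simp
  qed
  have "(\<Sum>i\<in>S. \<Sum>j\<in>S. w i * w j * (ip d (V i) (V j))\<^sup>2)
      = (\<Sum>i\<in>S. \<Sum>j\<in>S. \<Sum>p\<in>?K. (w i * V i (fst p) * V i (snd p)) * (w j * V j (fst p) * V j (snd p)))"
    unfolding power2_eq_square ip2 sum_distrib_left
    by (intro sum.cong refl) (auto simp: mult_ac)
  also have "\<dots> = (\<Sum>i\<in>S. \<Sum>p\<in>?K. \<Sum>j\<in>S. (w i * V i (fst p) * V i (snd p)) * (w j * V j (fst p) * V j (snd p)))"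
    by (intro sum.cong refl sum.swap)
  also have "\<dots> = (\<Sum>p\<in>?K. \<Sum>i\<in>S. \<Sum>j\<in>S. (w i * V i (fst p) * V i (snd p)) * (w j * V j (fst p) * V j (snd p)))"
    by (rule sum.swap)
  also have "\<dots> = (\<Sum>p\<in>?K. (M p)\<^sup>2)"
    unfolding power2_eq_square M_def by (intro sum.cong refl) (auto simp: sum_product)
  finally have 3: "(\<Sum>i\<in>S. \<Sum>j\<in>S. w i * w j * (ip d (V i) (V j))\<^sup>2) = (\<Sum>p\<in>?K. (M p)\<^sup>2)" .
  show ?thesis
    using Cauchy_Schwarz_ineq_sum[of M X ?K] unfolding 1 2 3 by simp
qed

text \<open>A bound affine in \<open>g^2\<close> replaces the indicator, so that it can be summed.
  Below 3/4 \<tau> the left side is not positive. Above it the loss \<tau> / 4 is at most a third of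
  the absolute value of \<open>g\<close>, which gives the factor 4/9, and \<open>h\<close> is at
  least \<tau> / 2 in absolute value, hence passes the threshold.\<close>

lemma thresholded_square_ge:
  fixes g h \<tau> :: real
  assumes "0 < \<tau>" "\<bar>g\<bar> - \<tau> / 4 \<le> \<bar>h\<bar>"
  shows "4 / 9 * (g\<^sup>2 - 9 / 16 * \<tau>\<^sup>2) \<le> of_bool (\<tau> / 4 * \<tau> \<le> h\<^sup>2) * h\<^sup>2"
proof (cases "\<bar>g\<bar> < 3 / 4 * \<tau>")
  case True
  then have "\<bar>g\<bar>\<^sup>2 \<le> (3 / 4 * \<tau>)\<^sup>2" by (intro power_mono) auto
  then have "4 / 9 * (g\<^sup>2 - 9 / 16 * \<tau>\<^sup>2) \<le> 0" by (simp add: power2_eq_square)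
  moreover have "0 \<le> of_bool (\<tau> / 4 * \<tau> \<le> h\<^sup>2) * h\<^sup>2" by simp
  ultimately show ?thesis by (rule order_trans)
next
  case False
  then have "2 / 3 * \<bar>g\<bar> \<le> \<bar>h\<bar>" "\<tau> / 2 \<le> \<bar>h\<bar>" using assms by auto
  then have "(2 / 3 * \<bar>g\<bar>)\<^sup>2 \<le> \<bar>h\<bar>\<^sup>2" "(\<tau> / 2)\<^sup>2 \<le> \<bar>h\<bar>\<^sup>2"
    using assms(1) by (intro power_mono; simp)+
  then have "4 / 9 * g\<^sup>2 \<le> h\<^sup>2" "\<tau> / 4 * \<tau> \<le> h\<^sup>2"
    by (simp_all add: power2_eq_square)
  then show ?thesis by (simp add: algebra_simps add_increasing2)
qed

text \<open>Averaging the candidates over \<open>S\<close> with weights \<open>w i\<close>. The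
  approximate normalisation leaves 4/9 * (1 - 9/16) = 7/36 of \<tau>^2 W, still more than the
  required 1/32. The bound \<open>b\<close> keeps the argument independent of how the best candidate
  is found.\<close>

lemma best_candidate_bound:
  assumes "0 < d" "0 < \<tau>" "(1 / 4) ^ m \<le> \<tau>\<^sup>2 / 2"
    and V: "\<And>i. i < n \<Longrightarrow> ip d (V i) (V i) \<le> 1" and w: "\<And>i. i < n \<Longrightarrow> 0 \<le> w i"
    and x: "ip d x x = 1"
    and best: "\<And>i. i < n \<Longrightarrow> threshold_value (\<tau> / 4 * \<tau>) n d V w (refl_vec m d (V i)) \<le> b"
    and "0 \<le> b"
  shows "\<tau>\<^sup>2 / 32 * threshold_value \<tau> n d V w x \<le> b"
proof -
  define S where "S = {i. i < n \<and> \<tau> \<le> (ip d x (V i))\<^sup>2}"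
  define W where "W = (\<Sum>i\<in>S. w i)"
  have S: "finite S" "S \<subseteq> {..<n}" unfolding S_def by auto
  have wS: "0 \<le> w i" if "i \<in> S" for i using that w by (simp add: S_def)
  have "0 \<le> W" unfolding W_def using wS by (simp add: sum_nonneg)
  have z: "(ip d x (V i))\<^sup>2 \<le> ip d (V i) (V i)" for i
    using ip_Cauchy_Schwarz[of d x "V i"] x by simp
  have cand: "4 / 9 * ((\<Sum>j\<in>S. w j * (ip d (V i) (V j))\<^sup>2) - 9 / 16 * \<tau>\<^sup>2 * W) \<le> b" if "i \<in> S" for i
  proof -
    let ?y = "refl_vec m d (V i)"
    \<comment> \<open>By Cauchy-Schwarz a vector satisfied by \<open>x\<close> has squared length at
      least \<tau>, as \<open>refl_vec_correlation\<close> demands.\<close>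
    have i: "i < n" "\<tau> \<le> ip d (V i) (V i)" using that z[of i] by (auto simp: S_def)
    have "4 / 9 * ((\<Sum>j\<in>S. w j * (ip d (V i) (V j))\<^sup>2) - 9 / 16 * \<tau>\<^sup>2 * W)
        = (\<Sum>j\<in>S. w j * (4 / 9 * ((ip d (V i) (V j))\<^sup>2 - 9 / 16 * \<tau>\<^sup>2)))"
      unfolding W_def by (simp add: sum_distrib_left sum_distrib_right sum_subtractf algebra_simps)
    also have "\<dots> \<le> (\<Sum>j\<in>S. w j * (of_bool (\<tau> / 4 * \<tau> \<le> (ip d ?y (V j))\<^sup>2) * (ip d ?y (V j))\<^sup>2))"
      using S_def i assms(1-3) V
      by (intro sum_mono mult_left_mono wS thresholded_square_ge refl_vec_correlation) auto
    also have "\<dots> \<le> (\<Sum>j<n. w j * (of_bool (\<tau> / 4 * \<tau> \<le> (ip d ?y (V j))\<^sup>2) * (ip d ?y (V j))\<^sup>2))"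
      using S w by (intro sum_mono2) auto
    also have "\<dots> = threshold_value (\<tau> / 4 * \<tau>) n d V w ?y"
      unfolding threshold_value_def by (simp add: mult_ac)
    also have "\<dots> \<le> b" using best i(1) by blast
    finally show ?thesis .
  qed
  have "\<tau> * W \<le> (\<Sum>i\<in>S. w i * (ip d x (V i))\<^sup>2)"
    unfolding W_def sum_distrib_left mult.commute[of \<tau>]
    using wS by (intro sum_mono mult_left_mono) (auto simp: S_def)
  then have "(\<tau> * W)\<^sup>2 \<le> (\<Sum>i\<in>S. w i * (ip d x (V i))\<^sup>2)\<^sup>2"
    using assms(2) \<open>0 \<le> W\<close> by (intro power_mono) auto
  also have "\<dots> \<le> (\<Sum>i\<in>S. \<Sum>j\<in>S. w i * w j * (ip d (V i) (V j))\<^sup>2)"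
    by (rule gram_squares_ge[OF S(1) x])
  finally have gram: "(\<tau> * W)\<^sup>2 \<le> (\<Sum>i\<in>S. \<Sum>j\<in>S. w i * w j * (ip d (V i) (V j))\<^sup>2)" .
  \<comment> \<open>The weighted sum of the bounds \<open>cand\<close>, whose double sum
    \<open>gram\<close> estimates from below.\<close>
  have "4 / 9 * ((\<Sum>i\<in>S. \<Sum>j\<in>S. w i * w j * (ip d (V i) (V j))\<^sup>2) - 9 / 16 * \<tau>\<^sup>2 * W * W)
      = (\<Sum>i\<in>S. w i * (4 / 9 * ((\<Sum>j\<in>S. w j * (ip d (V i) (V j))\<^sup>2) - 9 / 16 * \<tau>\<^sup>2 * W)))"
  proof -
    have "(\<Sum>i\<in>S. w i * (4 / 9 * ((\<Sum>j\<in>S. w j * (ip d (V i) (V j))\<^sup>2) - 9 / 16 * \<tau>\<^sup>2 * W)))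
      = (\<Sum>i\<in>S. 4 / 9 * (\<Sum>j\<in>S. w i * w j * (ip d (V i) (V j))\<^sup>2) - w i * (4 / 9 * (9 / 16 * \<tau>\<^sup>2 * W)))"
      by (intro sum.cong refl) (simp add: sum_distrib_left algebra_simps)
    also have "\<dots> = 4 / 9 * (\<Sum>i\<in>S. \<Sum>j\<in>S. w i * w j * (ip d (V i) (V j))\<^sup>2) - W * (4 / 9 * (9 / 16 * \<tau>\<^sup>2 * W))"
      unfolding sum_subtractf sum_distrib_left[symmetric] sum_distrib_right[symmetric] W_def[symmetric] ..
    finally show ?thesis by (simp add: algebra_simps)
  qed
  also have "\<dots> \<le> (\<Sum>i\<in>S. w i * b)"
    using cand wS by (intro sum_mono mult_left_mono) auto
  also have "\<dots> = W * b" by (simp add: W_def sum_distrib_right)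
  finally have "4 / 9 * ((\<tau> * W)\<^sup>2 - 9 / 16 * \<tau>\<^sup>2 * W * W) \<le> W * b" using gram by argo
  then have "W * (7 / 36 * \<tau>\<^sup>2 * W) \<le> W * b" by (simp add: power2_eq_square algebra_simps)
  \<comment> \<open>Cancelling \<open>W\<close> needs \<open>W\<close> positive; if
    \<open>W = 0\<close>, the claim is \<open>0 \<le> b\<close>.\<close>
  then have *: "7 / 36 * \<tau>\<^sup>2 * W \<le> b"
    using \<open>0 \<le> W\<close> \<open>0 \<le> b\<close> by (cases "W = 0") (auto simp: mult_le_cancel_left_pos)
  have "threshold_value \<tau> n d V w x = (\<Sum>i\<in>S. w i * (ip d x (V i))\<^sup>2)"
    unfolding threshold_value_def S_def
    by (rule sum.mono_neutral_cong_right) auto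
  also have "\<dots> \<le> (\<Sum>i\<in>S. w i * 1)"
    using z V S wS by (intro sum_mono mult_left_mono) (auto intro: order_trans)
  finally have le: "threshold_value \<tau> n d V w x \<le> W" by (simp add: W_def)
  have "\<tau>\<^sup>2 / 32 * threshold_value \<tau> n d V w x \<le> \<tau>\<^sup>2 / 32 * W"
    using le by (intro mult_left_mono) auto
  also have "\<dots> \<le> 7 / 36 * \<tau>\<^sup>2 * W"
    using \<open>0 \<le> W\<close> by (intro mult_right_mono) auto
  finally show ?thesis using * by linarith
qed


section \<open>The program\<close>

text \<open>Reals live in arrays only, so a real variable is cell 0 of an array of its own.\<close>

abbreviation scalar :: "string \<Rightarrow> rexp" where
  "scalar a \<equiv> RCell a (IConst 0)"

abbreviation set_scalar :: "string \<Rightarrow> rexp \<Rightarrow> com" where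
  "set_scalar a e \<equiv> RSet a (IConst 0) e"

abbreviation row_entry :: "string \<Rightarrow> rexp" where
  "row_entry b \<equiv> RCell ''v'' (IAdd (IReg b) (IReg ''k''))"

text \<open>Unrolled instead of looped: \<open>m\<close> is fixed with \<tau>, so this is still one
  program for all \<open>n\<close> and \<open>d\<close>.\<close>

fun newton_com :: "nat \<Rightarrow> com" where
  "newton_com 0 = set_scalar ''r'' (RConst 1)"
| "newton_com (Suc m) = Seq (newton_com m)
     (set_scalar ''r'' (RDiv (RAdd (scalar ''r'') (RDiv (scalar ''q'') (scalar ''r''))) (RConst 2)))"

lemma runs_newton_com:
  "runs (newton_com m) (R, A) (m + 1)
     (\<lambda>s. s = (R, A(''r'' := (A ''r'')(0 := newton_sqrt (A ''q'' 0) m))))"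
proof (induction m)
  case 0
  show ?case unfolding newton_com.simps by (rule runs_RSet) (simp_all add: fun_upd_def)
next
  case (Suc m)
  show ?case
    unfolding newton_com.simps
    by (rule runs_Seq[OF runs_mono[OF Suc order_refl], where T' = 1], hypsubst, rule runs_RSet)
       (auto simp: fun_upd_def intro!: ext)
qed

definition candidate_com :: "nat \<Rightarrow> com" where
  "candidate_com m =
    Seq (sum_loop ''q'' (RMul (row_entry ''b'') (row_entry ''b'')))
    (Seq (newton_com m)
    (Seq (If (RLess (RCell ''v'' (IReg ''b'')) (RConst 0))
            (set_scalar ''r'' (RSub (RConst 0) (scalar ''r''))) Skip)
    (Seq (set_scalar ''D'' (RAdd (RAdd (scalar ''q'')
            (RMul (RMul (RConst 2) (scalar ''r'')) (RCell ''v'' (IReg ''b''))))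
            (RMul (scalar ''r'') (scalar ''r''))))
    (Seq (fill_loop ''y'' (RMul (RDiv (RMul (RConst 2)
            (RAdd (RCell ''v'' (IReg ''b'')) (scalar ''r''))) (scalar ''D'')) (row_entry ''b'')))
      (set_scalar ''y'' (RSub (scalar ''y'') (RDiv (RSub (scalar ''q'')
            (RMul (scalar ''r'') (scalar ''r''))) (scalar ''D''))))))))"

text \<open>The premise on \<open>Q\<close> is a frame condition: callers learn the result and which
  registers and arrays may change, but no intermediate values.\<close>

lemma runs_candidate_com:
  fixes R :: "string \<Rightarrow> nat" and A :: "string \<Rightarrow> nat \<Rightarrow> real"
  defines "f \<equiv> \<lambda>k. A ''v'' (R ''b'' + k)"
  assumes d: "R ''d'' = d" "0 < d"
    and Q: "\<And>R' A'. (\<And>r. r \<noteq> ''k'' \<Longrightarrow> R' r = R r) \<Longrightarrow>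
      (\<And>a. a \<notin> {''q'', ''r'', ''D'', ''y''} \<Longrightarrow> A' a = A a) \<Longrightarrow>
      (\<And>k. k < d \<Longrightarrow> A' ''y'' k = refl_vec m d f k) \<Longrightarrow> Q (R', A')"
    and T: "6 * d + m + 10 \<le> T"
  shows "runs (candidate_com m) (R, A) T Q"
proof -
  \<comment> \<open>\<open>A1\<close> to \<open>A6\<close> are the memories after the successive
    commands. The loop writes the multiple of \<open>f\<close> into \<open>y\<close>, and the last
    assignment corrects entry 0 only.\<close>
  define R' where "R' = R(''k'' := d)"
  define A1 where "A1 = A(''q'' := (A ''q'')(0 := ip d f f))"
  define A2 where "A2 = A1(''r'' := (A ''r'')(0 := newton_sqrt (ip d f f) m))"
  define A3 where "A3 = A1(''r'' := (A ''r'')(0 := signed_root m d f))"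
  define A4 where "A4 = A3(''D'' := (A ''D'')(0 := refl_den m d f))"
  define z where "z = (\<lambda>k. if k < d then 2 * (f 0 + signed_root m d f) / refl_den m d f * f k else A ''y'' k)"
  define A5 where "A5 = A4(''y'' := z)"
  define A6 where "A6 = A4(''y'' := z(0 := refl_vec m d f 0))"
  note defs = A6_def A5_def A4_def A3_def A2_def A1_def R'_def
  have f: "A ''v'' (R ''b'') = f 0" "A ''v'' (R ''b'' + k) = f k" for k by (simp_all add: f_def)
  have "Q (R', A6)"
    using d(2) by (intro Q) (auto simp: defs z_def refl_vec_def)
  then have 6: "runs (set_scalar ''y'' (RSub (scalar ''y'') (RDiv (RSub (scalar ''q'')
            (RMul (scalar ''r'') (scalar ''r''))) (scalar ''D'')))) (R', A5) 1 Q"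
    using d(2) by (intro runs_RSet) (simp_all add: defs z_def refl_vec_def power2_eq_square)
  have 5: "runs (fill_loop ''y'' (RMul (RDiv (RMul (RConst 2)
            (RAdd (RCell ''v'' (IReg ''b'')) (scalar ''r''))) (scalar ''D'')) (row_entry ''b'')))
          (R', A4) (2 + d * 3) (\<lambda>s. s = (R', A5))"
    by (rule runs_fill_loop[where d = d and
          f = "\<lambda>k. 2 * (f 0 + signed_root m d f) / refl_den m d f * f k"])
       (simp_all add: defs d f z_def cong: if_cong)
  have 4: "runs (set_scalar ''D'' (RAdd (RAdd (scalar ''q'')
            (RMul (RMul (RConst 2) (scalar ''r'')) (RCell ''v'' (IReg ''b''))))
            (RMul (scalar ''r'') (scalar ''r'')))) (R', A3) 1 (\<lambda>s. s = (R', A4))"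
    by (rule runs_RSet) (simp_all add: defs f refl_den_def power2_eq_square)
  have 3: "runs (If (RLess (RCell ''v'' (IReg ''b'')) (RConst 0))
            (set_scalar ''r'' (RSub (RConst 0) (scalar ''r''))) Skip) (R', A2) 2 (\<lambda>s. s = (R', A3))"
    by (rule runs_If[where T = 1]; (rule runs_RSet runs_Skip)?)
       (simp_all add: defs f signed_root_def)
  have 2: "runs (newton_com m) (R', A1) (m + 1) (\<lambda>s. s = (R', A2))"
    using runs_newton_com[of m R' A1] by (simp add: defs)
  have 1: "runs (sum_loop ''q'' (RMul (row_entry ''b'') (row_entry ''b''))) (R, A) (3 + d * 3)
      (\<lambda>s. s = (R', A1))"
    by (rule runs_sum_loop[where d = d and f = "\<lambda>k. f k * f k"]) (simp_all add: defs d f ip_def)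
  show ?thesis
    unfolding candidate_com_def
    apply (rule runs_Seq[OF runs_mono[OF 1 order_refl], where T' = "3 * d + m + 7"])
     apply hypsubst
     apply (rule runs_Seq[OF runs_mono[OF 2 order_refl], where T' = "3 * d + 6"])
      apply hypsubst
      apply (rule runs_Seq[OF runs_mono[OF 3 order_refl], where T' = "3 * d + 4"])
       apply hypsubst
       apply (rule runs_Seq[OF runs_mono[OF 4 order_refl], where T' = "3 * d + 3"])
        apply hypsubst
        apply (rule runs_Seq[OF runs_mono[OF 5 order_refl], where T' = 1])
         apply (hypsubst, rule 6)
    using T by simp_all
qed

section \<open>Evaluating the objective at a candidate\<close>

text \<open>As indices cannot be multiplied, register \<open>c\<close> tracks the row offset \<open>j * d\<close>, and \<open>b\<close>
  tracks \<open>i * d\<close>.\<close>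

definition value_com :: com where
  "value_com =
    Seq (set_scalar ''val'' (RConst 0))
    (Seq (ISet ''c'' (IConst 0))
    (for_loop ''j'' ''n''
      (Seq (sum_loop ''g'' (RMul (RCell ''y'' (IReg ''k'')) (row_entry ''c'')))
      (Seq (If (RLess (RMul (scalar ''g'') (scalar ''g''))
                 (RMul (RDiv (scalar ''tau'') (RConst 4)) (scalar ''tau'')))
              Skip
              (set_scalar ''val'' (RAdd (scalar ''val'')
                 (RMul (RCell ''w'' (IReg ''j'')) (RMul (scalar ''g'') (scalar ''g''))))))
        (ISet ''c'' (IAdd (IReg ''c'') (IReg ''d'')))))))"

lemma threshold_value_Suc:
  "threshold_value \<theta> (Suc n) d V w y = threshold_value \<theta> n d V w y +
     of_bool (\<theta> \<le> (ip d y (V n))\<^sup>2) * (w n * (ip d y (V n))\<^sup>2)"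
  by (simp add: threshold_value_def)

lemma runs_value_com:
  fixes R :: "string \<Rightarrow> nat" and A :: "string \<Rightarrow> nat \<Rightarrow> real"
  defines "V \<equiv> \<lambda>j k. A ''v'' (j * R ''d'' + k)" and "\<theta> \<equiv> A ''tau'' 0 / 4 * A ''tau'' 0"
  assumes d: "R ''d'' = d" and n: "R ''n'' = n"
    and Q: "\<And>R' A'. (\<And>r. r \<notin> {''k'', ''j'', ''c''} \<Longrightarrow> R' r = R r) \<Longrightarrow>
      (\<And>a. a \<notin> {''g'', ''val''} \<Longrightarrow> A' a = A a) \<Longrightarrow>
      A' ''val'' 0 = threshold_value \<theta> n d V (A ''w'') (A ''y'') \<Longrightarrow> Q (R', A')"
    and T: "4 + n * (3 * d + 8) \<le> T"
  shows "runs value_com (R, A) T Q"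
proof -
  define I where "I = (\<lambda>i (R', A'). R' ''j'' = i \<and> R' ''c'' = i * d \<and>
    (\<forall>r. r \<notin> {''k'', ''j'', ''c''} \<longrightarrow> R' r = R r) \<and> (\<forall>a. a \<notin> {''g'', ''val''} \<longrightarrow> A' a = A a) \<and>
    A' ''val'' 0 = threshold_value \<theta> i d V (A ''w'') (A ''y''))"
  have body: "runs (Seq (sum_loop ''g'' (RMul (RCell ''y'' (IReg ''k'')) (row_entry ''c'')))
      (Seq (If (RLess (RMul (scalar ''g'') (scalar ''g''))
                 (RMul (RDiv (scalar ''tau'') (RConst 4)) (scalar ''tau'')))
              Skip
              (set_scalar ''val'' (RAdd (scalar ''val'')
                 (RMul (RCell ''w'' (IReg ''j'')) (RMul (scalar ''g'') (scalar ''g''))))))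
        (ISet ''c'' (IAdd (IReg ''c'') (IReg ''d''))))) s (3 * d + 6)
      (\<lambda>s'. fst s' ''j'' = i \<and> I (Suc i) (set_reg ''j'' (Suc i) s'))"
    if I: "I i s" for i s
  proof -
    obtain R1 A1 where s: "s = (R1, A1)" by fastforce
    define A2 where "A2 = A1(''g'' := (A1 ''g'')(0 := ip d (A ''y'') (V i)))"
    define R2 where "R2 = R1(''k'' := d)"
    define A3 where "A3 = A2(''val'' := (A2 ''val'')(0 := threshold_value \<theta> (Suc i) d V (A ''w'') (A ''y'')))"
    define R3 where "R3 = R2(''c'' := Suc i * d)"
    have R1: "R1 ''j'' = i" "R1 ''c'' = i * d" "\<And>r. r \<notin> {''k'', ''j'', ''c''} \<Longrightarrow> R1 r = R r"
      and A1: "\<And>a. a \<notin> {''g'', ''val''} \<Longrightarrow> A1 a = A a"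
        "A1 ''val'' 0 = threshold_value \<theta> i d V (A ''w'') (A ''y'')"
      using I by (auto simp: I_def s)
    have 1: "runs (sum_loop ''g'' (RMul (RCell ''y'' (IReg ''k'')) (row_entry ''c''))) (R1, A1)
        (3 + d * 3) (\<lambda>s. s = (R2, A2))"
      by (rule runs_sum_loop[where d = d and f = "\<lambda>k. A ''y'' k * V i k"])
         (simp_all add: R1 A1 d V_def A2_def R2_def ip_def)
    \<comment> \<open>Only strict comparison is available, so the test asks for failure and the
      \<open>else\<close> branch adds the term; equality with the threshold thus counts. In the
      \<open>Skip\<close> branch the new term is 0, so \<open>A3\<close> describes both
      outcomes.\<close>
    have 2: "runs (If (RLess (RMul (scalar ''g'') (scalar ''g''))
                 (RMul (RDiv (scalar ''tau'') (RConst 4)) (scalar ''tau'')))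
              Skip
              (set_scalar ''val'' (RAdd (scalar ''val'')
                 (RMul (RCell ''w'' (IReg ''j'')) (RMul (scalar ''g'') (scalar ''g'')))))) (R2, A2) 2
        (\<lambda>s. s = (R2, A3))"
      by (rule runs_If[where T = 1]; (rule runs_RSet runs_Skip)?)
         (simp_all add: R1 A1 A2_def R2_def A3_def threshold_value_Suc \<theta>_def power2_eq_square
           fun_upd_idem)
    have 3: "runs (ISet ''c'' (IAdd (IReg ''c'') (IReg ''d''))) (R2, A3) 1
      (\<lambda>s'. fst s' ''j'' = i \<and> I (Suc i) (set_reg ''j'' (Suc i) s'))"
      by (rule runs_ISet) (auto simp: I_def R1 A1 A2_def R2_def A3_def d)
    show ?thesis
      unfolding s
      apply (rule runs_Seq[OF runs_mono[OF 1 order_refl], where T' = 3])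
       apply hypsubst
       apply (rule runs_Seq[OF runs_mono[OF 2 order_refl], where T' = 1])
        apply (hypsubst, rule 3)
       apply simp_all
      done
  qed
  have loop: "runs (for_loop ''j'' ''n''
      (Seq (sum_loop ''g'' (RMul (RCell ''y'' (IReg ''k'')) (row_entry ''c'')))
      (Seq (If (RLess (RMul (scalar ''g'') (scalar ''g''))
                 (RMul (RDiv (scalar ''tau'') (RConst 4)) (scalar ''tau'')))
              Skip
              (set_scalar ''val'' (RAdd (scalar ''val'')
                 (RMul (RCell ''w'' (IReg ''j'')) (RMul (scalar ''g'') (scalar ''g''))))))
        (ISet ''c'' (IAdd (IReg ''c'') (IReg ''d''))))))
      (R(''c'' := 0), A(''val'' := (A ''val'')(0 := 0))) (2 + n * (3 * d + 6 + 2)) Q"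
  proof (rule runs_for_loop[where I = I and N = n])
    show "I 0 (set_reg ''j'' 0 (R(''c'' := 0), A(''val'' := (A ''val'')(0 := 0))))"
      by (simp add: I_def threshold_value_def)
    show "fst s ''j'' = i \<and> fst s ''n'' = n" if "I i s" for i s
      using that n by (cases s) (simp add: I_def)
    show "Q s" if "I n s" for s
    proof -
      obtain R' A' where s: "s = (R', A')" by fastforce
      show ?thesis unfolding s by (rule Q) (use that in \<open>simp_all add: I_def s\<close>)
    qed
  qed ((rule body; assumption) | rule order_refl)+
  show ?thesis
    unfolding value_com_def
    apply (rule runs_Seq[where T = 1 and T' = "3 + n * (3 * d + 8)"])
     apply (rule runs_RSet)
      apply (rule runs_Seq[where T = 1 and T' = "2 + n * (3 * d + 6 + 2)"])
       apply (rule runs_ISet)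
    using loop T by simp_all
qed

section \<open>The search over all candidates\<close>

definition tc_com :: "nat \<Rightarrow> com" where
  "tc_com m = Seq (set_scalar ''x'' (RConst 1))
    (for_loop ''i'' ''n''
      (Seq (candidate_com m)
      (Seq value_com
      (Seq (If (RLess (scalar ''best'') (scalar ''val''))
              (Seq (set_scalar ''best'' (scalar ''val'')) (fill_loop ''x'' (RCell ''y'' (IReg ''k''))))
              Skip)
        (ISet ''b'' (IAdd (IReg ''b'') (IReg ''d'')))))))"

lemma threshold_value_cong:
  assumes "\<And>k. k < d \<Longrightarrow> y k = y' k" "\<And>j k. j < n \<Longrightarrow> k < d \<Longrightarrow> V j k = V' j k"
    "\<And>j. j < n \<Longrightarrow> w j = w' j"
  shows "threshold_value \<theta> n d V w y = threshold_value \<theta> n d V' w' y'"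
  unfolding threshold_value_def using assms
  by (intro sum.cong refl) (simp add: ip_cong[of d y y' "V _" "V' _"])

text \<open>The invariant has \<open>best\<close> at most the value of \<open>x\<close>, not equal
  to it: initially \<open>best\<close> is 0, while the default \<open>x\<close>, the first unit
  vector, may have positive value. The default remains if no candidate has positive value.\<close>

lemma runs_tc_com:
  fixes R :: "string \<Rightarrow> nat" and A :: "string \<Rightarrow> nat \<Rightarrow> real"
  defines "V \<equiv> \<lambda>j k. A ''v'' (j * R ''d'' + k)" and "\<theta> \<equiv> A ''tau'' 0 / 4 * A ''tau'' 0"
  defines "val \<equiv> threshold_value \<theta> (R ''n'') (R ''d'') V (A ''w'')"
  assumes d: "R ''d'' = d" "0 < d" and n: "R ''n'' = n" and b: "R ''b'' = 0"
    and x: "\<And>k. A ''x'' k = 0" and best: "A ''best'' 0 = 0"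
    and w: "\<And>i. i < n \<Longrightarrow> 0 \<le> A ''w'' i"
    and V: "\<And>i. i < n \<Longrightarrow> ip d (V i) (V i) \<le> 1"
    and T: "3 + n * (9 * d + m + 21 + n * (3 * d + 8)) \<le> T"
  shows "runs (tc_com m) (R, A) T (\<lambda>(R', A').
     ip d (A' ''x'') (A' ''x'') = 1 \<and> 0 \<le> val (A' ''x'') \<and>
     (\<forall>i<n. val (refl_vec m d (V i)) \<le> val (A' ''x'')))"
proof -
  define I where "I = (\<lambda>i (R', A'). R' ''i'' = i \<and> R' ''b'' = i * d \<and> R' ''n'' = n \<and> R' ''d'' = d \<and>
    A' ''v'' = A ''v'' \<and> A' ''w'' = A ''w'' \<and> A' ''tau'' = A ''tau'' \<and>
    ip d (A' ''x'') (A' ''x'') = 1 \<and> 0 \<le> A' ''best'' 0 \<and> A' ''best'' 0 \<le> val (A' ''x'') \<and>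
    (\<forall>i'<i. val (refl_vec m d (V i')) \<le> A' ''best'' 0))"
  have val_cong: "val y = val y'" if "\<And>k. k < d \<Longrightarrow> y k = y' k" for y y'
    unfolding val_def using that d by (intro threshold_value_cong) auto
  have body: "runs (Seq (candidate_com m)
      (Seq value_com
      (Seq (If (RLess (scalar ''best'') (scalar ''val''))
              (Seq (set_scalar ''best'' (scalar ''val'')) (fill_loop ''x'' (RCell ''y'' (IReg ''k''))))
              Skip)
        (ISet ''b'' (IAdd (IReg ''b'') (IReg ''d'')))))) s (9 * d + m + 19 + n * (3 * d + 8))
      (\<lambda>s'. fst s' ''i'' = i \<and> I (Suc i) (set_reg ''i'' (Suc i) s'))"
    if i: "i < n" and I: "I i s" for i s
  proof -
    obtain R1 A1 where s: "s = (R1, A1)" by fastforce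
    let ?y = "refl_vec m d (V i)"
    have R1: "R1 ''i'' = i" "R1 ''b'' = i * d" "R1 ''n'' = n" "R1 ''d'' = d"
      and A1: "A1 ''v'' = A ''v''" "A1 ''w'' = A ''w''" "A1 ''tau'' = A ''tau''"
        "ip d (A1 ''x'') (A1 ''x'') = 1" "0 \<le> A1 ''best'' 0" "A1 ''best'' 0 \<le> val (A1 ''x'')"
        "\<And>i'. i' < i \<Longrightarrow> val (refl_vec m d (V i')) \<le> A1 ''best'' 0"
      using I by (auto simp: I_def s)
    define J1 where "J1 = (\<lambda>(R', A'). (\<forall>r. r \<noteq> ''k'' \<longrightarrow> R' r = R1 r) \<and>
      (\<forall>a. a \<notin> {''q'', ''r'', ''D'', ''y''} \<longrightarrow> A' a = A1 a) \<and> (\<forall>k<d. A' ''y'' k = ?y k))"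
    define J2 where "J2 = (\<lambda>(R', A'). (\<forall>r. r \<notin> {''k'', ''j'', ''c''} \<longrightarrow> R' r = R1 r) \<and>
      (\<forall>a. a \<notin> {''q'', ''r'', ''D'', ''y'', ''g'', ''val''} \<longrightarrow> A' a = A1 a) \<and>
      (\<forall>k<d. A' ''y'' k = ?y k) \<and> A' ''val'' 0 = val ?y)"
    \<comment> \<open>The invariant is stated for the registers as they will be after the two
      pending updates of \<open>i\<close> and \<open>b\<close>.\<close>
    define J3 where "J3 = (\<lambda>(R', A'). R' ''b'' = i * d \<and> I (Suc i) (R'(''i'' := Suc i, ''b'' := Suc i * d), A') \<and>
      R' ''i'' = i \<and> R' ''d'' = d)"
    have 1: "runs (candidate_com m) (R1, A1) (6 * d + m + 10) J1"
      by (rule runs_candidate_com[where d = d]) (simp_all add: J1_def R1 A1(1) V_def d)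
    have 2: "runs value_com s1 (4 + n * (3 * d + 8)) J2" if "J1 s1" for s1
    proof -
      obtain R2 A2 where s1: "s1 = (R2, A2)" by fastforce
      have R2: "\<And>r. r \<noteq> ''k'' \<Longrightarrow> R2 r = R1 r"
        and A2: "\<And>a. a \<notin> {''q'', ''r'', ''D'', ''y''} \<Longrightarrow> A2 a = A1 a" "\<And>k. k < d \<Longrightarrow> A2 ''y'' k = ?y k"
        using that by (auto simp: J1_def s1)
      have "val ?y = val (A2 ''y'')" using A2(2) by (intro val_cong) simp
      also have "\<dots> = threshold_value (A2 ''tau'' 0 / 4 * A2 ''tau'' 0) n d
          (\<lambda>j k. A2 ''v'' (j * R2 ''d'' + k)) (A2 ''w'') (A2 ''y'')"
        by (simp add: val_def \<theta>_def V_def A2(1) A1 R2 R1 d n)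
      finally have "val ?y = \<dots>" .
      then show ?thesis
        unfolding s1
        by (intro runs_value_com[where d = d and n = n]) (simp_all add: J2_def R2 R1 A2)
    qed
    have 3: "runs (If (RLess (scalar ''best'') (scalar ''val''))
        (Seq (set_scalar ''best'' (scalar ''val'')) (fill_loop ''x'' (RCell ''y'' (IReg ''k''))))
        Skip) s1 (3 * d + 4) J3" if "J2 s1" for s1
    proof -
      obtain R2 A2 where s1: "s1 = (R2, A2)" by fastforce
      have R2: "\<And>r. r \<notin> {''k'', ''j'', ''c''} \<Longrightarrow> R2 r = R1 r"
        and A2: "\<And>a. a \<notin> {''q'', ''r'', ''D'', ''y'', ''g'', ''val''} \<Longrightarrow> A2 a = A1 a"
          "\<And>k. k < d \<Longrightarrow> A2 ''y'' k = ?y k" "A2 ''val'' 0 = val ?y"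
        using that by (auto simp: J2_def s1)
      show ?thesis
      proof (cases "A1 ''best'' 0 < val ?y")
        case True
        \<comment> \<open>Copying overwrites the first \<open>d\<close> cells only, and these are
          all that \<open>ip\<close> and \<open>val\<close> read.\<close>
        define z where "z = (\<lambda>k. if k < d then A2 ''y'' k else A2 ''x'' k)"
        have "ip d z z = ip d ?y ?y" by (rule ip_cong) (simp_all add: z_def A2)
        also have "\<dots> = 1" using refl_vec_unit[OF d(2) V[OF i]] .
        finally have z: "ip d z z = 1" .
        have valz: "val z = val ?y" by (rule val_cong) (simp add: z_def A2)
        have "\<forall>i'<Suc i. val (refl_vec m d (V i')) \<le> val ?y"
          using True A1(7) by (auto simp: less_Suc_eq intro: order.trans[OF _ less_imp_le[OF True]])
        then have "J3 (R2(''k'' := d), A2(''best'' := (A2 ''best'')(0 := val ?y), ''x'' := z))"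
          using True A1(5) by (simp add: J3_def I_def R2 R1 A2 A1(1-4) z valz)
        then show ?thesis
          unfolding s1
          apply (intro runs_If[where T = "3 * d + 3"])
          subgoal
            apply (rule runs_Seq[where T = 1 and T' = "2 + d * 3"])
             apply (rule runs_RSet)
              apply (simp only: set_cell.simps)
              apply (rule runs_fill_loop[where d = d and f = "A2 ''y''"])
                 apply (simp_all add: R2 R1 A2(3) z_def cong: if_cong)
            done
          subgoal using True by (simp add: A2)
          subgoal by simp
          done
      next
        case False
        then have "\<forall>i'<Suc i. val (refl_vec m d (V i')) \<le> A1 ''best'' 0"
          using A1(7) by (auto simp: less_Suc_eq)
        then have "J3 (R2, A2)"
          by (simp add: J3_def I_def R2 R1 A2 A1(1-6))
        then show ?thesis
          unfolding s1 using False
          by (intro runs_If[where T = "3 * d + 3"] runs_Skip) (simp_all add: A2)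
      qed
    qed
    have 4: "runs (ISet ''b'' (IAdd (IReg ''b'') (IReg ''d''))) s1 1
      (\<lambda>s'. fst s' ''i'' = i \<and> I (Suc i) (set_reg ''i'' (Suc i) s'))" if "J3 s1" for s1
      using that
      by (intro runs_ISet; cases s1) (auto simp: J3_def add.commute fun_upd_twist[of "''b''" "''i''"])
    show ?thesis
      unfolding s
      apply (rule runs_Seq[OF runs_mono[OF 1 order_refl], where T' = "3 * d + 9 + n * (3 * d + 8)"])
       apply (rule runs_Seq[OF runs_mono[OF 2 order_refl], where T' = "3 * d + 5"])
         apply assumption
        apply (rule runs_Seq[OF runs_mono[OF 3 order_refl], where T' = 1])
          apply assumption
         apply (erule 4)
        apply simp_all
      done
  qed
  have "ip d ((A ''x'')(0 := 1)) ((A ''x'')(0 := 1)) = (\<Sum>k<d. if k = 0 then 1 else 0)"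
    unfolding ip_def by (intro sum.cong) (auto simp: x)
  then have x1: "ip d ((A ''x'')(0 := 1)) ((A ''x'')(0 := 1)) = 1" using d(2) by simp
  have val_nonneg: "0 \<le> val y" for y
    unfolding val_def threshold_value_def using w n by (auto intro!: sum_nonneg)
  have "runs (for_loop ''i'' ''n'' (Seq (candidate_com m)
      (Seq value_com
      (Seq (If (RLess (scalar ''best'') (scalar ''val''))
              (Seq (set_scalar ''best'' (scalar ''val'')) (fill_loop ''x'' (RCell ''y'' (IReg ''k''))))
              Skip)
        (ISet ''b'' (IAdd (IReg ''b'') (IReg ''d''))))))) (R, A(''x'' := (A ''x'')(0 := 1)))
    (2 + n * (9 * d + m + 19 + n * (3 * d + 8) + 2)) (\<lambda>(R', A').
     ip d (A' ''x'') (A' ''x'') = 1 \<and> 0 \<le> val (A' ''x'') \<and>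
     (\<forall>i<n. val (refl_vec m d (V i)) \<le> val (A' ''x'')))"
  proof (rule runs_for_loop[where I = I and N = n])
    show "I 0 (set_reg ''i'' 0 (R, A(''x'' := (A ''x'')(0 := 1))))"
      by (simp add: I_def d n b x1 best val_nonneg)
    show "fst s ''i'' = i \<and> fst s ''n'' = n" if "I i s" for i s
      using that by (cases s) (simp add: I_def)
    show "case s of (R', A') \<Rightarrow> ip d (A' ''x'') (A' ''x'') = 1 \<and> 0 \<le> val (A' ''x'') \<and>
     (\<forall>i<n. val (refl_vec m d (V i)) \<le> val (A' ''x''))" if "I n s" for s
      using that by (cases s) (auto simp: I_def val_nonneg intro: order_trans)
  qed ((rule body; assumption) | rule order_refl)+
  then show ?thesis
    unfolding tc_com_def using T
    by (intro runs_Seq[where T = 1 and T' = "2 + n * (9 * d + m + 19 + n * (3 * d + 8) + 2)"] runs_RSet)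
       (simp_all add: algebra_simps)
qed


section \<open>Correctness of the program\<close>

lemma scalar_prod_eq_ip: "v \<in> carrier_vec d \<Longrightarrow> scalar_prod x v = ip d (\<lambda>k. x $ k) (\<lambda>k. v $ k)"
  by (auto simp: scalar_prod_def ip_def atLeast0LessThan)

lemma vec_norm_eq_ip: "x \<in> carrier_vec d \<Longrightarrow> vec_norm x = sqrt (ip d (\<lambda>k. x $ k) (\<lambda>k. x $ k))"
  by (simp add: vec_norm_def scalar_prod_eq_ip[of x d x])

lemma tc_value_eq_threshold_value:
  assumes "\<And>i. i < n \<Longrightarrow> v i \<in> carrier_vec d"
  shows "tc_value \<theta> n v w x = threshold_value \<theta> n d (\<lambda>i k. v i $ k) w (\<lambda>k. x $ k)"
  unfolding tc_value_def threshold_value_def using assms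
  by (intro sum.cong refl) (simp add: scalar_prod_eq_ip[of "v _" d])

text \<open>As \<open>N \<ge> 1\<close>, every power of \<open>N\<close> that occurs is at most
  \<open>N^3\<close>, and the coefficients add up to \<open>m + 44\<close>.\<close>

lemma time_bound:
  fixes n d m :: nat
  shows "3 + n * (9 * d + m + 21 + n * (3 * d + 8)) \<le> (m + 44) * (1 + n + d) ^ 3"
proof -
  define N where "N = 1 + n + d"
  have "3 + n * (9 * d + m + 21 + n * (3 * d + 8)) \<le> 3 + N * (9 * N + m + 21 + N * (3 * N + 8))"
    unfolding N_def by (intro add_left_mono mult_mono add_mono order_refl) auto
  also have "\<dots> = 3 * N ^ 3 + 17 * N ^ 2 + (m + 21) * N ^ 1 + 3 * N ^ 0"
    by (simp add: power2_eq_square power3_eq_cube algebra_simps)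
  also have "\<dots> \<le> 3 * N ^ 3 + 17 * N ^ 3 + (m + 21) * N ^ 3 + 3 * N ^ 3"
    by (intro add_mono mult_left_mono power_increasing order_refl) (auto simp: N_def)
  also have "\<dots> = (m + 44) * N ^ 3" by (simp add: algebra_simps)
  finally show ?thesis unfolding N_def .
qed

lemma tc_com_correct:
  assumes inst: "tc_instance n d v w" and \<tau>: "0 < \<tau>" and m: "(1 / 4) ^ m \<le> \<tau>\<^sup>2 / 2"
  shows "\<exists>t s. exec (tc_com m) (tc_input \<tau> n d v w) t s \<and> t \<le> (m + 44) * (1 + n + d) ^ 3 \<and>
    tc_output d s \<in> unit_vecs d \<and>
    \<tau>\<^sup>2 / 32 * tc_opt \<tau> n d v w \<le> tc_value (\<tau> / 4 * \<tau>) n v w (tc_output d s)"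
proof -
  define R where "R = fst (tc_input \<tau> n d v w)"
  define A where "A = snd (tc_input \<tau> n d v w)"
  define V where "V = (\<lambda>j k. A ''v'' (j * R ''d'' + k))"
  have d: "0 < d" and v: "\<And>i. i < n \<Longrightarrow> v i \<in> carrier_vec d" "\<And>i. i < n \<Longrightarrow> vec_norm (v i) \<le> 1"
    and w: "\<And>i. i < n \<Longrightarrow> 0 \<le> w i"
    using inst by (auto simp: tc_instance_def)
  have RA: "R ''d'' = d" "R ''n'' = n" "R ''b'' = 0" "A ''tau'' 0 = \<tau>" "A ''best'' 0 = 0"
    "\<And>k. A ''x'' k = 0" "\<And>i. i < n \<Longrightarrow> A ''w'' i = w i"
    by (simp_all add: R_def A_def tc_input_def)
  have V: "V j k = v j $ k" if "j < n" "k < d" for j k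
  proof -
    \<comment> \<open>The cell lies inside the stored input, where division by \<open>d\<close>
      recovers row and coordinate.\<close>
    have "j * d + k < Suc j * d" using that by simp
    also have "\<dots> \<le> n * d" using that by (intro mult_right_mono) auto
    finally show ?thesis using that by (simp add: V_def R_def A_def tc_input_def)
  qed
  have V1: "ip d (V i) (V i) \<le> 1" if "i < n" for i
  proof -
    have "ip d (V i) (V i) = ip d (\<lambda>k. v i $ k) (\<lambda>k. v i $ k)"
      using that by (intro ip_cong) (auto simp: V)
    then show ?thesis using v(2)[OF that] vec_norm_eq_ip[OF v(1)[OF that]] by simp
  qed
  have tcv: "tc_value \<theta> n v w x = threshold_value \<theta> n d V (A ''w'') (\<lambda>k. x $ k)" for \<theta> x
    using tc_value_eq_threshold_value[of n v d \<theta> w x] v(1)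
      threshold_value_cong[of d "\<lambda>k. x $ k" "\<lambda>k. x $ k" n "\<lambda>i k. v i $ k" V w "A ''w''" \<theta>]
    by (simp add: V RA)
  have "runs (tc_com m) (R, A) ((m + 44) * (1 + n + d) ^ 3) (\<lambda>(R', A').
     ip d (A' ''x'') (A' ''x'') = 1 \<and>
     0 \<le> threshold_value (\<tau> / 4 * \<tau>) n d V (A ''w'') (A' ''x'') \<and>
     (\<forall>i<n. threshold_value (\<tau> / 4 * \<tau>) n d V (A ''w'') (refl_vec m d (V i))
        \<le> threshold_value (\<tau> / 4 * \<tau>) n d V (A ''w'') (A' ''x'')))"
    using runs_tc_com[of R d n A m "(m + 44) * (1 + n + d) ^ 3"] d w V1 time_bound[of n d m]
    by (simp add: V_def RA)
  then obtain t R' A' where run: "exec (tc_com m) (R, A) t (R', A')" "t \<le> (m + 44) * (1 + n + d) ^ 3"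
    and x: "ip d (A' ''x'') (A' ''x'') = 1"
    and nonneg: "0 \<le> threshold_value (\<tau> / 4 * \<tau>) n d V (A ''w'') (A' ''x'')"
    and best: "\<And>i. i < n \<Longrightarrow> threshold_value (\<tau> / 4 * \<tau>) n d V (A ''w'') (refl_vec m d (V i))
        \<le> threshold_value (\<tau> / 4 * \<tau>) n d V (A ''w'') (A' ''x'')"
    unfolding runs_def by auto
  define y where "y = tc_output d (R', A')"
  have y: "y \<in> carrier_vec d" "\<And>k. k < d \<Longrightarrow> y $ k = A' ''x'' k"
    by (auto simp: y_def tc_output_def)
  have "ip d (\<lambda>k. y $ k) (\<lambda>k. y $ k) = 1"
    using x ip_cong[of d "\<lambda>k. y $ k" "A' ''x''" "\<lambda>k. y $ k" "A' ''x''"] y(2) by simp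
  then have unit: "y \<in> unit_vecs d"
    using y(1) by (simp add: unit_vecs_def vec_norm_eq_ip)
  have tcy: "tc_value (\<tau> / 4 * \<tau>) n v w y = threshold_value (\<tau> / 4 * \<tau>) n d V (A ''w'') (A' ''x'')"
    unfolding tcv by (intro threshold_value_cong) (auto simp: y)
  \<comment> \<open>Dividing by \<tau>^2 / 32 gives a uniform upper bound on the objective, which
    passes to the supremum; the output itself shows that the set of unit vectors is
    nonempty.\<close>
  have "tc_value \<tau> n v w x \<le> 32 / \<tau>\<^sup>2 * tc_value (\<tau> / 4 * \<tau>) n v w y" if "x \<in> unit_vecs d" for x
  proof -
    have "ip d (\<lambda>k. x $ k) (\<lambda>k. x $ k) = 1"
      using that by (auto simp: unit_vecs_def vec_norm_eq_ip)
    then have "\<tau>\<^sup>2 / 32 * tc_value \<tau> n v w x \<le> tc_value (\<tau> / 4 * \<tau>) n v w y"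
      unfolding tcv[of \<tau>] tcy
      using best_candidate_bound[OF d \<tau> m V1 _ _ best nonneg, of "\<lambda>k. x $ k"] w RA(7) by auto
    then show ?thesis using \<tau> by (simp add: field_simps)
  qed
  then have "tc_opt \<tau> n d v w \<le> 32 / \<tau>\<^sup>2 * tc_value (\<tau> / 4 * \<tau>) n v w y"
    unfolding tc_opt_def using unit by (intro cSUP_least) auto
  then have "\<tau>\<^sup>2 / 32 * tc_opt \<tau> n d v w \<le> tc_value (\<tau> / 4 * \<tau>) n v w y"
    using \<tau> by (simp add: field_simps)
  then show ?thesis
    using run unit unfolding y_def R_def A_def by auto
qed

theorem theorem6:
  fixes \<tau> :: real
  assumes "0 < \<tau>" and "\<tau> < 1"
  shows "\<exists>P. tc_polynomial_time \<tau> P \<and>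
             tc_approximation_algorithm (\<tau> / 4) (\<tau>\<^sup>2 / 32) \<tau> P"
proof -
  have "0 < \<tau>\<^sup>2 / 2" using assms(1) by simp
  \<comment> \<open>\<open>m\<close> depends on \<tau> alone, so \<open>tc_com m\<close> serves all
    instances.\<close>
  then obtain m where "(1 / 4 :: real) ^ m < \<tau>\<^sup>2 / 2"
    using real_arch_pow_inv[of "\<tau>\<^sup>2 / 2" "1 / 4"] by auto
  then have m: "(1 / 4) ^ m \<le> \<tau>\<^sup>2 / 2" by simp
  have "tc_polynomial_time \<tau> (tc_com m)"
    unfolding tc_polynomial_time_def
    using tc_com_correct[OF _ assms(1) m]
    \<comment> \<open>At \<open>n + d\<close> this polynomial is the bound of
      \<open>time_bound\<close>.\<close>
    by (intro exI[of _ "smult (m + 44) ([:1, 1:] ^ 3)"]) (simp add: add.assoc, blast)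
  moreover have "tc_approximation_algorithm (\<tau> / 4) (\<tau>\<^sup>2 / 32) \<tau> (tc_com m)"
    unfolding tc_approximation_algorithm_def
    using tc_com_correct[OF _ assms(1) m] by blast
  ultimately show ?thesis by blast
qed

end
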